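(* Let $\mathcal{N}=(V,F)$ be a maximal directed mixed graph, let $\alpha,\beta\in V$, and assume that the directed edge $e$ from $\alpha$ to $\beta$ is in $\mathcal{N}$. Let $\mathcal{N}-e=(V,F\setminus\{e\})$. Then $\mathcal{N}-e$ is Markov equivalent to $\mathcal{N}$ if and only if $\alpha\in u(\beta,\mathcal{I}(\mathcal{N}-e))$, i.e. if and only if there is no $C\subseteq V\setminus\{\alpha\}$ such that $\beta$ is $\mu$-separated from $\alpha$ given $C$ in $\mathcal{N}-e$.
   Context: A directed mixed graph (DMG) $\mathcal{G}=(V,E)$ has a finite node set $V$ and an edge set $E=E_d\sqcup E_b$, where $E_d$ is a set of ordered pairs of nodes (directed edges $\alpha\rightarrow\beta$, with $\alpha=\beta$ allowed) and $E_b$ is a set of unordered pairs (bidirected edges $\alpha\leftrightarrow\beta$, with $\alpha=\beta$ allowed). Several edges may be present between the same two nodes. The edge $\alpha\rightarrow\beta$ has a tail at $\alpha$ and a head at $\beta$; $\alpha\leftrightarrow\beta$ has heads at both ends. A walk is a sequence $\langle\gamma_1,e_1,\gamma_2,\ldots,e_n,\gamma_{n+1}\rangle$ with $e_i$ an edge between $\gamma_i$ and $\gamma_{i+1}$, together with an orientation of each directed loop on it (pointing towards $\gamma_1$ or towards $\gamma_{n+1}$); nodes and edges may repeat. It is nontrivial if $n\ge 1$. A non-endpoint occurrence $\gamma_i$ ($1<i<n+1$) is a collider if $e_{i-1}$ and $e_i$ both have heads at that occurrence, and otherwise a noncollider; endpoints are neither. For $C\subseteq V$, $An(C)$ is the set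 of nodes from which there is a directed path $\gamma\rightarrow\cdots\rightarrow c$ (possibly of length zero) to some $c\in C$; thus $C\subseteq An(C)$. A nontrivial walk from $\alpha$ to $\beta$ is $\mu$-connecting given $C$ if $\alpha\notin C$, every collider is in $An(C)$, no noncollider is in $C$, and the last edge has a head at (the final) $\beta$. For $A,B,C\subseteq V$ (not necessarily disjoint), $B$ is $\mu$-separated from $A$ given $C$ if there is no $\mu$-connecting walk from any $\alpha\in A$ to any $\beta\in B$ given $C$. $\mathcal{I}(\mathcal{G})$ is the set of triples $\langle A,B\mid C\rangle$ of subsets of $V$ such that $B$ is $\mu$-separated from $A$ given $C$ in $\mathcal{G}$. DMGs $\mathcal{G}_1,\mathcal{G}_2$ on the same node set are Markov equivalent if $\mathcal{I}(\mathcal{G}_1)=\mathcal{I}(\mathcal{G}_2)$. A DMG is maximal if it is complete (contains all possible directed and bidirected edges, including loops, on $V$), or if adding any edge not already present changes the induced independence model $\mathcal{I}(\cdot)$. For an independence model $\mathcal{I}$ over $V$ (a set of triples of subsets of $V$), $u(\beta,\mathcal{I})$ is the set of $\gamma\in V$ for which there is no $C\subseteq V\setminus\{\gamma\}$ with $\langle\{\gamma\},\{\beta\}\mid C\rangle\in\mathcal{I}$. *)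

theory Defs
  imports Main "HOL-Library.Uprod"
begin

datatype 'a edge = Directed 'a 'a | Bidirected "'a uprod"

record 'a dmg =
  nodes :: "'a set"
  edges :: "'a edge set"

definition all_edges :: "'a set \<Rightarrow> 'a edge set" where
  "all_edges V = {Directed a b | a b. a \<in> V \<and> b \<in> V}
               \<union> {Bidirected (Upair a b) | a b. a \<in> V \<and> b \<in> V}"

definition is_dmg :: "'a dmg \<Rightarrow> bool" where
  "is_dmg G \<longleftrightarrow> finite (nodes G) \<and> edges G \<subseteq> all_edges (nodes G)"

definition add_edge :: "'a dmg \<Rightarrow> 'a edge \<Rightarrow> 'a dmg" where
  "add_edge G e = G\<lparr>edges := insert e (edges G)\<rparr>"

definition del_edge :: "'a dmg \<Rightarrow> 'a edge \<Rightarrow> 'a dmg" where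
  "del_edge G e = G\<lparr>edges := edges G - {e}\<rparr>"

text \<open>
  A walk is given by its list of nodes and, for each pair of consecutive nodes \<open>x\<close>, \<open>y\<close>,
  a mark saying whether the edge traversed is \<open>x \<rightarrow> y\<close>, \<open>x \<leftarrow> y\<close> or \<open>x \<leftrightarrow> y\<close>.
  For \<open>x \<noteq> y\<close> the mark determines and is determined by the edge; for a directed loop (\<open>x = y\<close>)
  it is the orientation that is part of the data of a walk.
\<close>

datatype mark = Fwd | Bwd | Bid

fun edge_of :: "mark \<Rightarrow> 'a \<Rightarrow> 'a \<Rightarrow> 'a edge" where
  "edge_of Fwd x y = Directed x y"
| "edge_of Bwd x y = Directed y x"
| "edge_of Bid x y = Bidirected (Upair x y)"

definition head_at_left :: "mark \<Rightarrow> bool" where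
  "head_at_left m \<longleftrightarrow> m = Bwd \<or> m = Bid"

definition head_at_right :: "mark \<Rightarrow> bool" where
  "head_at_right m \<longleftrightarrow> m = Fwd \<or> m = Bid"

definition is_walk :: "'a dmg \<Rightarrow> 'a list \<Rightarrow> mark list \<Rightarrow> bool" where
  "is_walk G xs ms \<longleftrightarrow>
     length xs = Suc (length ms) \<and> set xs \<subseteq> nodes G \<and>
     (\<forall>i < length ms. edge_of (ms ! i) (xs ! i) (xs ! Suc i) \<in> edges G)"

text \<open>
  The position \<open>i\<close> in \<open>xs\<close> is a non-endpoint iff \<open>0 < i < length ms\<close>; the edges adjacent to it
  are those with marks \<open>ms ! (i - 1)\<close> and \<open>ms ! i\<close>.
\<close>

definition is_collider :: "mark list \<Rightarrow> nat \<Rightarrow> bool" where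
  "is_collider ms i \<longleftrightarrow>
     0 < i \<and> i < length ms \<and> head_at_right (ms ! (i - 1)) \<and> head_at_left (ms ! i)"

definition is_noncollider :: "mark list \<Rightarrow> nat \<Rightarrow> bool" where
  "is_noncollider ms i \<longleftrightarrow> 0 < i \<and> i < length ms \<and> \<not> is_collider ms i"

definition An :: "'a dmg \<Rightarrow> 'a set \<Rightarrow> 'a set" where
  "An G C = {x \<in> nodes G. \<exists>c \<in> C. (x, c) \<in> {(a, b). Directed a b \<in> edges G}\<^sup>*}"

definition mu_connecting :: "'a dmg \<Rightarrow> 'a set \<Rightarrow> 'a list \<Rightarrow> mark list \<Rightarrow> bool" where
  "mu_connecting G C xs ms \<longleftrightarrow>
     is_walk G xs ms \<and> ms \<noteq> [] \<and> hd xs \<notin> C \<and>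
     (\<forall>i. is_collider ms i \<longrightarrow> xs ! i \<in> An G C) \<and>
     (\<forall>i. is_noncollider ms i \<longrightarrow> xs ! i \<notin> C) \<and>
     head_at_right (last ms)"

text \<open>\<open>mu_separated G A B C\<close>: the set \<open>B\<close> is \<open>\<mu>\<close>-separated from \<open>A\<close> given \<open>C\<close>.\<close>

definition mu_separated :: "'a dmg \<Rightarrow> 'a set \<Rightarrow> 'a set \<Rightarrow> 'a set \<Rightarrow> bool" where
  "mu_separated G A B C \<longleftrightarrow>
     \<not> (\<exists>xs ms. mu_connecting G C xs ms \<and> hd xs \<in> A \<and> last xs \<in> B)"

definition indep_model :: "'a dmg \<Rightarrow> ('a set \<times> 'a set \<times> 'a set) set" where
  "indep_model G =
     {(A, B, C). A \<subseteq> nodes G \<and> B \<subseteq> nodes G \<and> C \<subseteq> nodes G \<and> mu_separated G A B C}"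

definition markov_equivalent :: "'a dmg \<Rightarrow> 'a dmg \<Rightarrow> bool" where
  "markov_equivalent G1 G2 \<longleftrightarrow> nodes G1 = nodes G2 \<and> indep_model G1 = indep_model G2"

definition is_complete :: "'a dmg \<Rightarrow> bool" where
  "is_complete G \<longleftrightarrow> edges G = all_edges (nodes G)"

definition is_maximal :: "'a dmg \<Rightarrow> bool" where
  "is_maximal G \<longleftrightarrow>
     is_complete G \<or>
     (\<forall>e \<in> all_edges (nodes G) - edges G. indep_model (add_edge G e) \<noteq> indep_model G)"

definition u_set ::
  "'a set \<Rightarrow> 'a \<Rightarrow> ('a set \<times> 'a set \<times> 'a set) set \<Rightarrow> 'a set" where
  "u_set V b I = {c \<in> V. \<not> (\<exists>C \<subseteq> V - {c}. ({c}, {b}, C) \<in> I)}"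

end

theory Submission
  imports Defs
begin

text \<open>
  If \<open>\<beta>\<close> cannot be separated from \<open>\<alpha>\<close> in \<open>N' = N - e\<close>, conditioning on the ancestors of
  \<open>{\<alpha>, \<beta>}\<close> other than \<open>\<alpha>\<close> yields an inducing walk from \<open>\<alpha>\<close> to \<open>\<beta>\<close> in \<open>N'\<close>: all its
  non-endpoints are colliders and ancestors of \<open>\<alpha>\<close> or \<open>\<beta>\<close>. If \<open>N'\<close> has a nontrivial directed
  path from \<open>\<alpha>\<close> to \<open>\<beta>\<close>, then adding \<open>e\<close> to \<open>N'\<close> changes nothing, because every use of \<open>e\<close> can
  be replaced by the inducing walk or by the directed path. Otherwise maximality of \<open>N\<close> forces the
  walk to start with a head, hence \<open>\<alpha> \<leftrightarrow> \<beta>\<close> is in \<open>N\<close>; by maximality again every edge with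
  a head at \<open>\<alpha>\<close> has a counterpart into \<open>\<beta>\<close>. Then \<open>\<alpha> \<rightarrow> \<beta>\<close> is replaced by \<open>\<alpha> \<leftrightarrow> \<beta>\<close>,
  or, after an edge \<open>\<gamma>\<close> to \<open>\<alpha>\<close> with a head at \<open>\<alpha>\<close>, both edges are replaced by the one from \<open>\<gamma>\<close> to \<open>\<beta>\<close>.
\<close>

section \<open>Walks as a relation between endpoints and end marks\<close>

text \<open>In \<open>step G x l y r\<close> the flags \<open>l\<close> and \<open>r\<close> say whether the edge has a head at \<open>x\<close> and \<open>y\<close>.\<close>

definition step :: "'a dmg \<Rightarrow> 'a \<Rightarrow> bool \<Rightarrow> 'a \<Rightarrow> bool \<Rightarrow> bool" where
  "step G x l y r \<longleftrightarrow>
     (\<exists>m. edge_of m x y \<in> edges G \<and> l = head_at_left m \<and> r = head_at_right m)"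

abbreviation dir :: "'a dmg \<Rightarrow> ('a \<times> 'a) set" where
  "dir G \<equiv> {(a, b). Directed a b \<in> edges G}"

text \<open>The condition on a non-endpoint \<open>y\<close> entered with mark \<open>r\<close> and
  left with mark \<open>l\<close>: two heads make it a collider.\<close>

definition passes :: "'a set \<Rightarrow> 'a set \<Rightarrow> bool \<Rightarrow> bool \<Rightarrow> 'a \<Rightarrow> bool" where
  "passes A C r l y \<longleftrightarrow> (if r \<and> l then y \<in> A else y \<notin> C)"

text \<open>
  \<open>conn E A C x l y r\<close>: a walk from \<open>x\<close> to \<open>y\<close> with colliders in \<open>A\<close>, noncolliders outside \<open>C\<close>
  and end marks \<open>l\<close>, \<open>r\<close>. The membership of the endpoints is left unconstrained.
\<close>

inductive conn :: "('a \<Rightarrow> bool \<Rightarrow> 'a \<Rightarrow> bool \<Rightarrow> bool) \<Rightarrow> 'a set \<Rightarrow> 'a set \<Rightarrow>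
    'a \<Rightarrow> bool \<Rightarrow> 'a \<Rightarrow> bool \<Rightarrow> bool"
  for E A C where
  single: "E x l y r \<Longrightarrow> conn E A C x l y r"
| snoc: "conn E A C x l y r \<Longrightarrow> E y l' z r' \<Longrightarrow> passes A C r l' y \<Longrightarrow> conn E A C x l z r'"

lemma step_iff:
  "step G x l y r \<longleftrightarrow>
     (\<not> l \<and> r \<and> Directed x y \<in> edges G) \<or> (l \<and> \<not> r \<and> Directed y x \<in> edges G) \<or>
     (l \<and> r \<and> Bidirected (Upair x y) \<in> edges G)"
proof -
  have "(\<exists>m. P m) \<longleftrightarrow> P Fwd \<or> P Bwd \<or> P Bid" for P
    by (metis mark.exhaust)
  then show ?thesis
    unfolding step_def by (auto simp: head_at_left_def head_at_right_def)
qed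

lemma step_sym: "step G x l y r \<Longrightarrow> step G y r x l"
proof -
  have "Upair x y = Upair y x" by (simp add: Upair_inject)
  then show "step G x l y r \<Longrightarrow> step G y r x l" unfolding step_iff by auto
qed

lemma step_nodes: "is_dmg G \<Longrightarrow> step G x l y r \<Longrightarrow> x \<in> nodes G \<and> y \<in> nodes G"
  unfolding step_iff is_dmg_def all_edges_def by (auto simp: Upair_inject subset_iff)

lemma conn_join:
  "conn E A C y l' z r' \<Longrightarrow> conn E A C x l y r \<Longrightarrow> passes A C r l' y \<Longrightarrow> conn E A C x l z r'"
  by (induction rule: conn.induct) (auto intro: conn.snoc)

text \<open>\<open>E'\<close> is kept apart from \<open>E\<close> because walks are later reversed
  along an edge relation that is not symmetric.\<close>

lemma conn_rev:
  assumes "conn E A C x l y r" and E: "\<And>x l y r. E x l y r \<Longrightarrow> E' y r x l"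
  shows "conn E' A C y r x l"
  using assms(1)
proof (induction rule: conn.induct)
  case (single x l y r)
  then show ?case by (simp add: E conn.single)
next
  case (snoc x l y r l' z r')
  have "passes A C l' r y" using snoc.hyps by (auto simp: passes_def)
  with snoc.IH conn.single[of E', OF E[OF snoc.hyps(2)]] show ?case
    by (rule conn_join)
qed

lemma conn_step_rev: "conn (step G) A C x l y r \<Longrightarrow> conn (step G) A C y r x l"
  by (erule conn_rev) (rule step_sym)

lemma conn_mono:
  assumes "conn E A C x l y r" and "\<And>x l y r. E x l y r \<Longrightarrow> E' x l y r" and "A \<subseteq> A'" and "C' \<subseteq> C"
  shows "conn E' A' C' x l y r"
  using assms(1)
proof (induction rule: conn.induct)
  case (snoc x l y r l' z r')
  have "passes A' C' r l' y" using snoc.hyps assms by (auto simp: passes_def split: if_splits)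
  then show ?case using snoc assms(2) by (blast intro: conn.snoc)
qed (auto intro: conn.single assms)

text \<open>Replacing a tail by a head is harmless at \<open>x \<in> A - C\<close>, which blocks in neither role.\<close>

lemma conn_replace:
  assumes "conn E A C x l y r" and "l \<or> x \<notin> C" and "r \<or> y \<notin> C"
    and E: "\<And>x l y r. E x l y r \<Longrightarrow> l \<or> x \<notin> C \<Longrightarrow> r \<or> y \<notin> C \<Longrightarrow>
      \<exists>l' r'. (l' = l \<or> l' \<and> x \<in> A) \<and> (r' = r \<or> r' \<and> y \<in> A) \<and> conn E' A C x l' y r'"
  shows "\<exists>l' r'. (l' = l \<or> l' \<and> x \<in> A) \<and> (r' = r \<or> r' \<and> y \<in> A) \<and> conn E' A C x l' y r'"
  using assms(1-3)
proof (induction rule: conn.induct)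
  case (single x l y r)
  then show ?case by (rule E)
next
  case (snoc x l y r m z s)
  \<comment> \<open>A tail at \<open>y\<close> on one side makes \<open>y\<close> a noncollider,
    hence outside \<open>C\<close>.\<close>
  have ry: "r \<or> y \<notin> C" "m \<or> y \<notin> C"
    using snoc.hyps by (auto simp: passes_def split: if_splits)
  obtain l' r' where 1: "l' = l \<or> l' \<and> x \<in> A" "r' = r \<or> r' \<and> y \<in> A" "conn E' A C x l' y r'"
    using snoc.IH[OF snoc.prems(1) ry(1)] by (elim exE conjE)
  obtain m' s' where 2: "m' = m \<or> m' \<and> y \<in> A" "s' = s \<or> s' \<and> z \<in> A" "conn E' A C y m' z s'"
    using E[OF snoc.hyps(2) ry(2) snoc.prems(2)] by (elim exE conjE)
  have "passes A C r' m' y"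
    using snoc.hyps 1 2 ry by (auto simp: passes_def split: if_splits)
  from conn_join[OF 2(3) 1(3) this] show ?case using 1(1) 2(2) by (intro exI conjI)
qed

lemma conn_cons_cases:
  assumes "conn E A C x l y r"
  obtains "E x l y r"
  | z s m where "E x l z s" "passes A C s m z" "conn E A C z m y r"
  using assms
proof (induction arbitrary: thesis rule: conn.induct)
  case (single x l y r)
  then show ?case by blast
next
  case (snoc x l y r l' z r')
  show ?case
  proof (rule snoc.IH)
    assume "E x l y r"
    then show thesis using snoc.prems(2) conn.single[where E = E, OF snoc.hyps(2)] snoc.hyps(3) by blast
  next
    fix w s m
    assume "E x l w s" "passes A C s m w" "conn E A C w m y r"
    then show thesis using snoc.prems(2) conn.snoc[where E = E, OF _ snoc.hyps(2,3)] by blast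
  qed
qed

section \<open>Walks as lists and walks as a relation\<close>

text \<open>\<open>mu_connecting\<close> without its conditions on the first node and the last mark,
  so that nontrivial prefixes inherit it and induction at the end is possible.\<close>

definition open_walk :: "'a dmg \<Rightarrow> 'a set \<Rightarrow> 'a set \<Rightarrow> 'a list \<Rightarrow> mark list \<Rightarrow> bool" where
  "open_walk G A C xs ms \<longleftrightarrow> is_walk G xs ms \<and> ms \<noteq> [] \<and>
     (\<forall>i. is_collider ms i \<longrightarrow> xs ! i \<in> A) \<and> (\<forall>i. is_noncollider ms i \<longrightarrow> xs ! i \<notin> C)"

lemma open_walk_passes:
  "open_walk G A C xs ms \<longleftrightarrow> is_walk G xs ms \<and> ms \<noteq> [] \<and>
     (\<forall>i < length ms. 0 < i \<longrightarrow>
        passes A C (head_at_right (ms ! (i - 1))) (head_at_left (ms ! i)) (xs ! i))"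
  unfolding open_walk_def is_collider_def is_noncollider_def passes_def by auto

lemma is_walk_snoc:
  assumes "length xs = Suc (length ms)"
  shows "is_walk G (xs @ [z]) (ms @ [m]) \<longleftrightarrow>
    is_walk G xs ms \<and> z \<in> nodes G \<and> edge_of m (last xs) z \<in> edges G"
proof -
  have "xs \<noteq> []" using assms by auto
  then have l: "last xs = xs ! length ms" using assms by (simp add: last_conv_nth)
  show ?thesis
    unfolding is_walk_def using assms l
    by (auto simp: nth_append All_less_Suc)
qed

lemma open_walk_snoc:
  assumes "length xs = Suc (length ms)" and "ms \<noteq> []"
  shows "open_walk G A C (xs @ [z]) (ms @ [m]) \<longleftrightarrow>
    open_walk G A C xs ms \<and> z \<in> nodes G \<and> edge_of m (last xs) z \<in> edges G \<and>
    passes A C (head_at_right (last ms)) (head_at_left m) (last xs)"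
proof -
  have "xs \<noteq> []" using assms by auto
  then have l: "last xs = xs ! length ms" "last ms = ms ! (length ms - 1)"
    using assms by (simp_all add: last_conv_nth)
  show ?thesis
    unfolding open_walk_passes is_walk_snoc[OF assms(1)] using assms l
    by (auto simp: nth_append All_less_Suc)
qed

lemma open_walk_single:
  "open_walk G A C [x, y] [m] \<longleftrightarrow> x \<in> nodes G \<and> y \<in> nodes G \<and> edge_of m x y \<in> edges G"
  unfolding open_walk_passes is_walk_def by auto

lemma conn_imp_open_walk:
  assumes "conn (step G) A C x l y r" and "is_dmg G"
  shows "\<exists>xs ms. open_walk G A C xs ms \<and> hd xs = x \<and> last xs = y \<and> head_at_right (last ms) = r"
  using assms(1)
proof (induction rule: conn.induct)
  case (single x l y r)
  then obtain m where "edge_of m x y \<in> edges G" "r = head_at_right m"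
    unfolding step_def by blast
  moreover have "x \<in> nodes G" "y \<in> nodes G" using step_nodes[OF assms(2) single] by auto
  ultimately have "open_walk G A C [x, y] [m] \<and> hd [x, y] = x \<and> last [x, y] = y \<and>
      head_at_right (last [m]) = r"
    by (simp add: open_walk_single)
  then show ?case by blast
next
  case (snoc x l y r l' z r')
  then obtain xs ms where w: "open_walk G A C xs ms" "hd xs = x" "last xs = y"
      "head_at_right (last ms) = r" by blast
  obtain m where m: "edge_of m y z \<in> edges G" "l' = head_at_left m" "r' = head_at_right m"
    using snoc.hyps unfolding step_def by blast
  have len: "length xs = Suc (length ms)" "ms \<noteq> []"
    using w by (auto simp: open_walk_def is_walk_def)
  have "open_walk G A C (xs @ [z]) (ms @ [m])"
    using w m snoc.hyps step_nodes[OF assms(2) snoc.hyps(2)] by (auto simp: open_walk_snoc[OF len])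
  moreover have "hd (xs @ [z]) = x" using len w by (cases xs) auto
  ultimately show ?case using m by (metis last_snoc)
qed

lemma open_walk_imp_conn:
  "open_walk G A C xs ms \<Longrightarrow> \<exists>l. conn (step G) A C (hd xs) l (last xs) (head_at_right (last ms))"
proof (induction ms arbitrary: xs rule: rev_induct)
  case Nil
  then show ?case by (simp add: open_walk_def)
next
  case (snoc m ms)
  have len: "length xs = Suc (Suc (length ms))"
    using snoc.prems by (simp add: open_walk_def is_walk_def)
  then obtain ys z where xs: "xs = ys @ [z]" by (metis length_Suc_conv_rev)
  have len': "length ys = Suc (length ms)" using len xs by simp
  show ?case
  proof (cases "ms = []")
    case True
    then obtain y where "ys = [y]" using len' by (cases ys) auto
    then have "edge_of m y z \<in> edges G" using snoc.prems True xs by (simp add: open_walk_single)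
    then have "step G y (head_at_left m) z (head_at_right m)" unfolding step_def by blast
    then show ?thesis using \<open>ys = [y]\<close> xs by (auto intro: conn.single)
  next
    case False
    note s = snoc.prems[unfolded xs open_walk_snoc[OF len' False]]
    then obtain l where "conn (step G) A C (hd ys) l (last ys) (head_at_right (last ms))"
      using snoc.IH by blast
    moreover have "step G (last ys) (head_at_left m) z (head_at_right m)"
      using s unfolding step_def by blast
    ultimately have "conn (step G) A C (hd ys) l z (head_at_right m)"
      using s by (blast intro: conn.snoc)
    moreover have "hd xs = hd ys" using xs len' by (cases ys) auto
    ultimately show ?thesis using xs by auto
  qed
qed

lemma mu_separated_conn:
  assumes "is_dmg G"
  shows "mu_separated G A B C \<longleftrightarrow>
    \<not> (\<exists>x\<in>A. \<exists>y\<in>B. \<exists>l. x \<notin> C \<and> conn (step G) (An G C) C x l y True)"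
proof -
  have mu: "mu_connecting G C xs ms \<longleftrightarrow>
      open_walk G (An G C) C xs ms \<and> hd xs \<notin> C \<and> head_at_right (last ms)" for xs ms
    unfolding mu_connecting_def open_walk_def by auto
  have "(\<exists>xs ms. mu_connecting G C xs ms \<and> hd xs = x \<and> last xs = y) \<longleftrightarrow>
      x \<notin> C \<and> (\<exists>l. conn (step G) (An G C) C x l y True)" for x y
    unfolding mu
  proof (intro iffI; clarify)
    fix xs ms
    assume "open_walk G (An G C) C xs ms" and h: "head_at_right (last ms)"
    from open_walk_imp_conn[OF this(1)] h
    show "\<exists>l. conn (step G) (An G C) C (hd xs) l (last xs) True" by simp
  next
    fix l
    assume "x \<notin> C" "conn (step G) (An G C) C x l y True"
    from conn_imp_open_walk[OF this(2) assms] this(1)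
    show "\<exists>xs ms. (open_walk G (An G C) C xs ms \<and> hd xs \<notin> C \<and> head_at_right (last ms)) \<and>
        hd xs = x \<and> last xs = y" by auto
  qed
  then show ?thesis unfolding mu_separated_def by metis
qed

text \<open>The mark \<open>l\<close> at the start may change from one graph to the other, as
  connection restricts only the mark at the end.\<close>

lemma indep_model_eqI:
  assumes "is_dmg G" "is_dmg H" "nodes G = nodes H"
    and "\<And>C x l y. C \<subseteq> nodes G \<Longrightarrow> x \<notin> C \<Longrightarrow> conn (step G) (An G C) C x l y True \<Longrightarrow>
      \<exists>l. conn (step H) (An H C) C x l y True"
    and "\<And>C x l y. C \<subseteq> nodes G \<Longrightarrow> x \<notin> C \<Longrightarrow> conn (step H) (An H C) C x l y True \<Longrightarrow>
      \<exists>l. conn (step G) (An G C) C x l y True"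
  shows "indep_model G = indep_model H"
proof -
  have "mu_separated G A B C \<longleftrightarrow> mu_separated H A B C" if "C \<subseteq> nodes G" for A B C
    unfolding mu_separated_conn[OF assms(1)] mu_separated_conn[OF assms(2)]
    using assms(4,5)[OF that] by blast
  then show ?thesis unfolding indep_model_def using assms(3) by auto
qed

section \<open>Ancestors, directed paths and inducing walks\<close>

lemma An_trans: "(x, y) \<in> (dir G)\<^sup>* \<Longrightarrow> y \<in> An G C \<Longrightarrow> x \<in> nodes G \<Longrightarrow> x \<in> An G C"
  unfolding An_def by (auto intro: rtrancl_trans)

lemma An_self: "x \<in> C \<Longrightarrow> x \<in> nodes G \<Longrightarrow> x \<in> An G C"
  unfolding An_def by blast

lemma An_mono: "nodes G = nodes H \<Longrightarrow> edges G \<subseteq> edges H \<Longrightarrow> C \<subseteq> D \<Longrightarrow> An G C \<subseteq> An H D"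
proof -
  assume a: "nodes G = nodes H" "edges G \<subseteq> edges H" "C \<subseteq> D"
  have "(dir G)\<^sup>* \<subseteq> (dir H)\<^sup>*" using a by (intro rtrancl_mono) auto
  then show ?thesis unfolding An_def using a by blast
qed

lemma An_An: "An G (An G C) \<subseteq> An G C"
  unfolding An_def by (auto intro: rtrancl_trans)

lemma dir_nodes: "is_dmg G \<Longrightarrow> (x, y) \<in> dir G \<Longrightarrow> x \<in> nodes G \<and> y \<in> nodes G"
  unfolding is_dmg_def all_edges_def by auto

text \<open>A node of the path in \<open>C\<close> would make \<open>x\<close> an ancestor of
  \<open>C\<close>; so its non-endpoints, all noncolliders, avoid \<open>C\<close>.\<close>

lemma conn_directed:
  assumes "(x, y) \<in> (dir G)\<^sup>+" "x \<in> nodes G" "x \<notin> An G C" "is_dmg G"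
  shows "conn (step G) A C x False y True"
  using assms(1)
proof (induction rule: trancl_induct)
  case (base y)
  then show ?case by (auto intro!: conn.single simp: step_iff)
next
  case (step y z)
  have "y \<in> nodes G" using dir_nodes[OF assms(4) step.hyps(2)] by simp
  then have "y \<notin> C"
    using An_trans[OF trancl_into_rtrancl[OF step.hyps(1)]] An_self[of y C G] assms by blast
  then have "passes A C True False y" by (simp add: passes_def)
  moreover have "Submission.step G y False z True" using step.hyps by (simp add: step_iff)
  ultimately show ?case using conn.snoc[OF step.IH] by blast
qed

text \<open>
  With \<open>C = UNIV\<close> no noncolliders are allowed, so the assumption describes an inducing walk.
  At its first collider outside \<open>An G C\<close> one leaves along the directed path to an endpoint.
\<close>

lemma conn_inducing:
  assumes "conn (step G) (An G {x, y}) UNIV x l y True" and "l \<or> x \<in> An G {y}" and "is_dmg G"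
  shows "conn (step G) (An G C) C x l y True"
proof -
  \<comment> \<open>Induction over prefixes: the end of the prefix is reached by an open walk, or
    some collider has already given a way to \<open>y\<close>.\<close>
  have "conn (step G) (An G C) C x l z r \<or> conn (step G) (An G C) C x l y True"
    if "conn (step G) (An G {x, y}) UNIV x' l' z r" "x' = x" "l' = l" for x' l' z r
    using that
  proof (induction rule: conn.induct)
    case (single x' l' z r)
    then show ?case by (auto intro: conn.single)
  next
    case (snoc x' l' z r m z' r')
    have z: "r" "m" "z \<in> An G {x, y}" using snoc.hyps(3) by (simp_all add: passes_def split: if_splits)
    then have zn: "z \<in> nodes G" by (auto simp: An_def)
    have ?case if c: "conn (step G) (An G C) C x l z r"
    proof (cases "z \<in> An G C")
      case True
      then show ?thesis using c snoc.hyps z by (auto intro!: conn.snoc[OF c] simp: passes_def)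
    next
      case False
      then have zC: "z \<notin> C" using An_self zn by metis
      show ?thesis
      proof (cases "z \<in> An G {y}")
        case True
        show ?thesis
        proof (cases "z = y")
          case True
          then show ?thesis using c z by simp
        next
          case ne: False
          have "(z, y) \<in> (dir G)\<^sup>*" using True by (auto simp: An_def)
          then have "(z, y) \<in> (dir G)\<^sup>+" using ne by (metis rtranclD)
          from conn_directed[OF this zn False assms(3)]
          have "conn (step G) (An G C) C z False y True" .
          from conn_join[OF this c] zC show ?thesis by (auto simp: passes_def)
        qed
      next
        case notAn: False
        then have zx: "(z, x) \<in> (dir G)\<^sup>*" using z(3) by (auto simp: An_def)
        \<comment> \<open>If \<open>x\<close> were an ancestor of \<open>y\<close>, then so would be
          \<open>z\<close>.\<close>
        have l: l using assms(2) notAn An_trans[OF zx _ zn] by blast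
        show ?thesis
        proof (cases "z = x")
          case True
          then show ?thesis using snoc.hyps l z by (auto intro: conn.single)
        next
          case ne: False
          then have "(z, x) \<in> (dir G)\<^sup>+" using zx by (metis rtranclD)
          \<comment> \<open>The prefix up to \<open>z\<close> is discarded in favour of the reversed
            path from \<open>x\<close> to \<open>z\<close>, whose head at \<open>x\<close> agrees
            with \<open>l\<close>.\<close>
          from conn_step_rev[OF conn_directed[OF this zn False assms(3)]]
          have "conn (step G) (An G C) C x True z False" .
          from conn.snoc[OF this snoc.hyps(2)] zC show ?thesis using l by (auto simp: passes_def)
        qed
      qed
    qed
    then show ?case using snoc.IH snoc.prems by blast
  qed
  with assms show ?thesis by blast
qed

section \<open>Redundant edges, and their presence in maximal graphs\<close>

lemma step_add: "step G x l y r \<Longrightarrow> step (add_edge G e) x l y r"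
  by (auto simp: step_iff add_edge_def)

lemma add_edge_simps [simp]:
  "nodes (add_edge G e) = nodes G" "edges (add_edge G e) = insert e (edges G)"
  by (simp_all add: add_edge_def)

lemma is_dmg_add: "is_dmg G \<Longrightarrow> e \<in> all_edges (nodes G) \<Longrightarrow> is_dmg (add_edge G e)"
  by (simp add: is_dmg_def)

text \<open>With unchanged ancestors, only the uses of the new edge need replacing;
  \<open>conn_replace\<close> extends this to whole walks.\<close>

lemma indep_model_add_edge:
  assumes "is_dmg G" "e \<in> all_edges (nodes G)" and An: "\<And>C. An (add_edge G e) C = An G C"
    and E: "\<And>C x l y r. step (add_edge G e) x l y r \<Longrightarrow> \<not> step G x l y r \<Longrightarrow>
      l \<or> x \<notin> C \<Longrightarrow> r \<or> y \<notin> C \<Longrightarrow>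
      \<exists>l' r'. (l' = l \<or> l' \<and> x \<in> An G C) \<and> (r' = r \<or> r' \<and> y \<in> An G C) \<and>
        conn (step G) (An G C) C x l' y r'"
  shows "indep_model (add_edge G e) = indep_model G"
proof (rule indep_model_eqI)
  fix C x l y
  assume C: "C \<subseteq> nodes (add_edge G e)" "x \<notin> C"
    and "conn (step (add_edge G e)) (An (add_edge G e) C) C x l y True"
  then have "conn (step (add_edge G e)) (An G C) C x l y True" by (simp add: An)
  then have "\<exists>l' r'. (l' = l \<or> l' \<and> x \<in> An G C) \<and> (r' = True \<or> r' \<and> y \<in> An G C) \<and>
        conn (step G) (An G C) C x l' y r'"
  proof (rule conn_replace)
    fix u k v s
    assume "step (add_edge G e) u k v s" "k \<or> u \<notin> C" "s \<or> v \<notin> C"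
    then show "\<exists>l' r'. (l' = k \<or> l' \<and> u \<in> An G C) \<and> (r' = s \<or> r' \<and> v \<in> An G C) \<and>
        conn (step G) (An G C) C u l' v r'"
      using E[of u k v s C] conn.single[of "step G" u k v s "An G C" C] by blast
  qed (use C in auto)
  then obtain l' r' where "r' = True \<or> r'" "conn (step G) (An G C) C x l' y r'" by blast
  then show "\<exists>l. conn (step G) (An G C) C x l y True" by auto
next
  fix C x l y
  assume "conn (step G) (An G C) C x l y True"
  then have "conn (step (add_edge G e)) (An G C) C x l y True"
    by (rule conn_mono) (auto intro: step_add)
  then show "\<exists>l. conn (step (add_edge G e)) (An (add_edge G e) C) C x l y True"
    by (auto simp: An)
qed (use assms is_dmg_add in auto)

lemma indep_model_add_directed:
  assumes "is_dmg G" "(x, y) \<in> (dir G)\<^sup>+" "x \<in> nodes G" "y \<in> nodes G"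
    and ind: "conn (step G) (An G {x, y}) UNIV x l y True"
  shows "indep_model (add_edge G (Directed x y)) = indep_model G"
proof (rule indep_model_add_edge)
  show "is_dmg G" by fact
  show "Directed x y \<in> all_edges (nodes G)" using assms by (auto simp: all_edges_def)
  have "dir (add_edge G (Directed x y)) = insert (x, y) (dir G)" by auto
  moreover have "(insert (x, y) (dir G))\<^sup>* = (dir G)\<^sup>*"
  proof
    show "(insert (x, y) (dir G))\<^sup>* \<subseteq> (dir G)\<^sup>*"
      using assms(2) by (intro rtrancl_subset_rtrancl) auto
    show "(dir G)\<^sup>* \<subseteq> (insert (x, y) (dir G))\<^sup>*" by (intro rtrancl_mono) blast
  qed
  ultimately show "An (add_edge G (Directed x y)) C = An G C" for C
    unfolding An_def by simp
next
  fix C u k v s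
  assume st: "step (add_edge G (Directed x y)) u k v s" "\<not> step G u k v s"
    and kC: "k \<or> u \<notin> C" "s \<or> v \<notin> C"
  have xy: "x \<in> An G {y}" using assms(2,3) by (auto simp: An_def)
  have c: "conn (step G) (An G C) C x l y True"
    using conn_inducing[OF ind _ assms(1)] xy by blast
  \<comment> \<open>If \<open>x\<close> is an ancestor of \<open>C\<close>, the inducing walk serves
    with either mark at \<open>x\<close>; otherwise the directed path is open and starts with a
    tail, like the new edge.\<close>
  have *: "\<exists>l'. (\<not> l' \<or> x \<in> An G C) \<and> conn (step G) (An G C) C x l' y True"
    using c conn_directed[OF assms(2,3) _ assms(1)] by blast
  then obtain l' where l': "\<not> l' \<or> x \<in> An G C" "conn (step G) (An G C) C x l' y True" by blast
  from st consider "u = x" "v = y" "\<not> k" "s" | "u = y" "v = x" "k" "\<not> s"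
    by (auto simp: step_iff)
  then show "\<exists>l' r'. (l' = k \<or> l' \<and> u \<in> An G C) \<and> (r' = s \<or> r' \<and> v \<in> An G C) \<and>
        conn (step G) (An G C) C u l' v r'"
    using l'(1) l'(2) conn_step_rev[OF l'(2)] by cases blast+
qed

lemma indep_model_add_bidirected:
  assumes "is_dmg G" "x \<in> nodes G" "y \<in> nodes G"
    and ind: "conn (step G) (An G {x, y}) UNIV x True y True"
  shows "indep_model (add_edge G (Bidirected (Upair x y))) = indep_model G"
proof (rule indep_model_add_edge)
  show "is_dmg G" by fact
  show "Bidirected (Upair x y) \<in> all_edges (nodes G)" using assms by (auto simp: all_edges_def)
  show "An (add_edge G (Bidirected (Upair x y))) C = An G C" for C
    unfolding An_def by simp
next
  fix C u k v s
  assume st: "step (add_edge G (Bidirected (Upair x y))) u k v s" "\<not> step G u k v s"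
  have c: "conn (step G) (An G C) C x True y True"
    using conn_inducing[OF ind _ assms(1)] by blast
  from st have "k" "s" "u = x \<and> v = y \<or> u = y \<and> v = x" by (auto simp: step_iff)
  then show "\<exists>l' r'. (l' = k \<or> l' \<and> u \<in> An G C) \<and> (r' = s \<or> r' \<and> v \<in> An G C) \<and>
        conn (step G) (An G C) C u l' v r'"
    using c conn_step_rev[OF c] by auto
qed

lemma maximal_edgeI:
  "is_maximal G \<Longrightarrow> e \<in> all_edges (nodes G) \<Longrightarrow> indep_model (add_edge G e) = indep_model G \<Longrightarrow>
    e \<in> edges G"
  unfolding is_maximal_def is_complete_def by blast

lemma maximal_directedI:
  assumes "is_maximal G" "is_dmg G" "(x, y) \<in> (dir G)\<^sup>+" "x \<in> nodes G" "y \<in> nodes G"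
    and "conn (step G) (An G {x, y}) UNIV x l y True"
  shows "Directed x y \<in> edges G"
proof (rule maximal_edgeI[OF assms(1)])
  show "Directed x y \<in> all_edges (nodes G)" using assms by (auto simp: all_edges_def)
qed (rule indep_model_add_directed[OF assms(2-)])

lemma maximal_bidirectedI:
  assumes "is_maximal G" "is_dmg G" "x \<in> nodes G" "y \<in> nodes G"
    and "conn (step G) (An G {x, y}) UNIV x True y True"
  shows "Bidirected (Upair x y) \<in> edges G"
proof (rule maximal_edgeI[OF assms(1)])
  show "Bidirected (Upair x y) \<in> all_edges (nodes G)" using assms by (auto simp: all_edges_def)
qed (rule indep_model_add_bidirected[OF assms(2-)])

section \<open>From inseparability to an inducing walk\<close>

text \<open>
  Condition on all ancestors of \<open>a\<close> and \<open>b\<close> other than \<open>a\<close>: every node of a connecting walk is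
  then an ancestor of \<open>a\<close> or \<open>b\<close>, so that only \<open>a\<close> can be a noncollider.
\<close>

lemma inducing_walk_exists:
  assumes "is_dmg G" "a \<in> nodes G" "b \<in> nodes G"
    and con: "\<And>C. C \<subseteq> nodes G - {a} \<Longrightarrow> \<exists>l. conn (step G) (An G C) C a l b True"
  shows "\<exists>l. conn (step G) (An G {a, b} - {a}) UNIV a l b True"
proof -
  define D where "D = An G {a, b}"
  define C where "C = D - {a}"
  let ?K = "conn (step G) (An G C) C"
  let ?I = "conn (step G) (D - {a}) UNIV"
  have ab: "a \<in> D" "b \<in> D" using assms by (auto simp: D_def intro: An_self)
  have AC: "An G C \<subseteq> D"
    using An_mono[of G G C D] An_An[of G "{a, b}"] by (auto simp: C_def D_def)
  have up: "z \<in> D" if "step G y l z False" "y \<in> D" for y l z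
    using An_trans[of z y G "{a, b}"] that step_nodes[OF assms(1) that(1)]
    by (auto simp: step_iff D_def)
  \<comment> \<open>A tail at \<open>z\<close> belongs to an edge from \<open>z\<close> into its
    predecessor, which is the start, a collider, or again entered by a tail.\<close>
  have tail: "z \<in> D" if "?K x l z r" "x \<in> D" "\<not> r" for x l z r
    using that
  proof (induction rule: conn.induct)
    case (single x l y r)
    then show ?case using up by simp
  next
    case (snoc x l y r l' z r')
    have l': "l'" using snoc.hyps(2) snoc.prems(2) by (simp add: step_iff)
    then have "y \<in> D" using snoc AC by (cases r) (auto simp: passes_def)
    then show ?case using snoc up l' by simp
  qed
  \<comment> \<open>The walk is read from \<open>b\<close>; the premise on \<open>z\<close> retains
    the part between \<open>a\<close> and \<open>z\<close>, so that \<open>tail\<close> applies from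
    both sides. Reading stops at the first visit to \<open>a\<close>, which thus never becomes a
    non-endpoint.\<close>
  have main: "?I b True z l \<or> (\<exists>l. ?I b True a l)"
    if "?K b' s z l" "b' = b" "s = True" "z = a \<or> (\<exists>l0 r. ?K a l0 z r \<and> passes (An G C) C r l z)"
    for b' s z l
    using that
  proof (induction rule: conn.induct)
    case (single b' s z l)
    then show ?case by (auto intro: conn.single)
  next
    case (snoc b' s y r m z l)
    have zy: "step G z l y m" using snoc.hyps(2) by (rule step_sym)
    from snoc.prems(3) obtain l0 where l0: "?K a l0 y m"
    proof (elim disjE exE conjE)
      assume "z = a"
      with zy have "step G a l y m" by simp
      from conn.single[where E = "step G", OF this] show thesis by (rule that)
    next
      fix l0 r
      assume "?K a l0 z r" "passes (An G C) C r l z"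
      from conn.snoc[where E = "step G", OF this(1) zy this(2)] show thesis by (rule that)
    qed
    have "passes (An G C) C m r y" using snoc.hyps(3) by (auto simp: passes_def)
    then have IH: "?I b True y r \<or> (\<exists>l. ?I b True a l)"
      using snoc.IH snoc.prems l0 by blast
    have "?K b True y r" using snoc by simp
    \<comment> \<open>A collider is in \<open>An G C\<close>; a noncollider has a tail on one side,
      and \<open>tail\<close> applies to the walk from that side.\<close>
    then have "y \<in> D"
      using snoc.hyps(3) tail[OF l0] tail[of b True y r] ab AC
      by (auto simp: passes_def split: if_splits)
    show ?case
    proof (cases "y = a")
      case True
      then show ?thesis using IH by blast
    next
      case False
      \<comment> \<open>Being in \<open>C\<close>, \<open>y\<close> cannot be a noncollider.\<close>
      then have "y \<in> C" using \<open>y \<in> D\<close> by (simp add: C_def)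
      then have p: "passes (D - {a}) UNIV r m y"
        using snoc.hyps(3) False \<open>y \<in> D\<close> by (auto simp: passes_def split: if_splits)
      from IH show ?thesis
      proof
        assume "?I b True y r"
        from conn.snoc[where E = "step G", OF this snoc.hyps(2) p] show ?thesis ..
      qed simp
    qed
  qed
  have "C \<subseteq> nodes G - {a}" by (auto simp: C_def D_def An_def)
  from con[OF this] obtain l where "?K a l b True" by blast
  from main[OF conn_step_rev[OF this]] obtain l where "?I b True a l" by blast
  from conn_step_rev[OF this] show ?thesis unfolding D_def by blast
qed

section \<open>Rerouting walks around the deleted edge\<close>

text \<open>The last edge is exchanged for its counterpart into \<open>b\<close>. For a loop leaving
  \<open>a\<close> by a tail, that counterpart could be the deleted edge itself. Such a loop is
  dropped: what remains ends with a head at \<open>a\<close> and is redirected in turn, or the edge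
  \<open>ab\<close> is appended, where \<open>a\<close> is at most a noncollider.\<close>

lemma conn_redirect_end:
  assumes "conn E A C x l a True" "a \<notin> C" and ab: "E a True b True"
    and into: "\<And>x l. E x l a True \<Longrightarrow> E x l b True \<or> x = a \<and> \<not> l"
  shows "\<exists>l'. (l \<longrightarrow> l') \<and> conn E A C x l' b True"
proof -
  have "\<exists>l'. (l \<longrightarrow> l') \<and> conn E A C x l' b True"
    if "conn E A C x l y r" "y = a" "r = True" for y r
    using that
  proof (induction rule: conn.induct)
    case (single x l y r)
    then have "E x l b True \<or> x = a \<and> \<not> l" using into by blast
    then show ?case
    proof
      assume "E x l b True"
      from conn.single[where E = E, OF this] show ?thesis by blast
    next
      assume "x = a \<and> \<not> l"
      then show ?thesis using conn.single[where E = E, OF ab] by auto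
    qed
  next
    case (snoc x l y r m z s)
    then have "E y m b True \<or> y = a \<and> \<not> m" using into by blast
    then show ?case
    proof
      assume "E y m b True"
      from conn.snoc[where E = E, OF snoc.hyps(1) this snoc.hyps(3)] show ?thesis by blast
    next
      assume y: "y = a \<and> \<not> m"
      show ?thesis
      proof (cases r)
        case True
        then show ?thesis using snoc.IH y by blast
      next
        case False
        then have p: "passes A C r True y" using y assms(2) by (simp add: passes_def)
        have "E y True b True" using y ab by simp
        from conn.snoc[where E = E, OF snoc.hyps(1) this p] show ?thesis by blast
      qed
    qed
  qed
  with assms show ?thesis by blast
qed

text \<open>Handles traversals from \<open>a\<close> to \<open>b\<close> only. At the start,
  \<open>ab\<close> takes over and only the first mark changes. Elsewhere \<open>a\<close> is a
  noncollider outside \<open>C\<close>: entered by a tail, it remains one when \<open>ab\<close>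
  takes over; entered by a head, the walk so far is redirected to \<open>b\<close>.\<close>

lemma conn_remove_edge:
  assumes "conn E' A C x l y r" "l \<or> x \<notin> C" and ab: "E a True b True"
    and into: "\<And>x l. E x l a True \<Longrightarrow> E x l b True \<or> x = a \<and> \<not> l"
    and E': "\<And>x l y r. E' x l y r \<Longrightarrow> E x l y r \<or> x = a \<and> \<not> l \<and> y = b \<and> r"
  shows "\<exists>l'. (l \<longrightarrow> l') \<and> conn E A C x l' y r"
  using assms(1,2)
proof (induction rule: conn.induct)
  case (single x l y r)
  from E'[OF this(1)] show ?case
  proof
    assume "E x l y r"
    from conn.single[where E = E, OF this] show ?thesis by blast
  next
    assume "x = a \<and> \<not> l \<and> y = b \<and> r"
    then show ?thesis using conn.single[where E = E, OF ab] by auto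
  qed
next
  case (snoc x l y r m z s)
  then obtain l' where l': "l \<longrightarrow> l'" "conn E A C x l' y r" by blast
  from E'[OF snoc.hyps(2)] show ?case
  proof
    assume "E y m z s"
    from conn.snoc[where E = E, OF l'(2) this snoc.hyps(3)] l'(1) show ?thesis by blast
  next
    assume e: "y = a \<and> \<not> m \<and> z = b \<and> s"
    then have aC: "a \<notin> C" using snoc.hyps(3) by (simp add: passes_def)
    show ?thesis
    proof (cases r)
      case True
      then have "conn E A C x l' a True" using l' e by simp
      from conn_redirect_end[where E = E, OF this aC ab into] show ?thesis using l' e by auto
    next
      case False
      then have p: "passes A C r True y" using aC e by (simp add: passes_def)
      have "E y True b True" using ab e by simp
      from conn.snoc[where E = E, OF l'(2) this p] show ?thesis using l' e by auto
    qed
  qed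
qed

lemma del_edge_simps [simp]:
  "nodes (del_edge G e) = nodes G" "edges (del_edge G e) = edges G - {e}"
  by (simp_all add: del_edge_def)

lemma is_dmg_del: "is_dmg G \<Longrightarrow> is_dmg (del_edge G e)"
  by (auto simp: is_dmg_def)

lemma add_del_edge: "e \<in> edges G \<Longrightarrow> add_edge (del_edge G e) e = G"
  by (simp add: add_edge_def del_edge_def insert_absorb)

lemma step_del: "step (del_edge G e) x l y r \<Longrightarrow> step G x l y r"
  by (auto simp: step_iff)

lemma An_del: "An (del_edge G e) C \<subseteq> An G C"
  by (rule An_mono) auto

text \<open>If a directed path uses the deleted edge, its part before the first use ends in
  \<open>a\<close>, and its part after the last use leads from \<open>b\<close> to
  \<open>C\<close>.\<close>

lemma An_del_directed:
  assumes "z \<in> An G C" "is_dmg G"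
  shows "z \<in> An (del_edge G (Directed a b)) C \<or>
    (z, a) \<in> (dir (del_edge G (Directed a b)))\<^sup>* \<and> b \<in> An (del_edge G (Directed a b)) C"
proof -
  let ?H = "del_edge G (Directed a b)"
  obtain c where c: "c \<in> C" "(z, c) \<in> (dir G)\<^sup>*" and z: "z \<in> nodes G"
    using assms by (auto simp: An_def)
  from c(2) z show ?thesis
  proof (induction rule: converse_rtrancl_induct)
    case base
    then show ?case using An_self[of c C ?H] c(1) by simp
  next
    case (step y z)
    have z: "z \<in> nodes G" using dir_nodes[OF assms(2) step.hyps(1)] by simp
    show ?case
    proof (cases "y = a \<and> z = b")
      case True
      then show ?thesis using step.IH z by auto
    next
      case False
      then have yz: "(y, z) \<in> dir ?H" using step.hyps by auto
      show ?thesis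
        using step.IH[OF z] An_trans[of y z ?H C] yz step.prems
        by (auto intro: converse_rtrancl_into_rtrancl)
    qed
  qed
qed

text \<open>
  A collider \<open>z\<close> that is an ancestor of \<open>C\<close> only through \<open>a \<rightarrow> b\<close> is replaced by the detour
  \<open>z \<rightarrow> \<dots> \<rightarrow> a \<rightarrow> b \<leftarrow> a \<leftarrow> \<dots> \<leftarrow> z\<close>, whose only collider is \<open>b\<close>.
\<close>

lemma conn_An_del:
  assumes "conn (step G) (An G C) C x l y r" "is_dmg G" "Directed a b \<in> edges G"
  shows "conn (step G) (An (del_edge G (Directed a b)) C) C x l y r"
  using assms(1)
proof (induction rule: conn.induct)
  case (single x l y r)
  then show ?case by (rule conn.single)
next
  case (snoc x l y r m z s)
  let ?H = "del_edge G (Directed a b)"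
  let ?K = "conn (step G) (An ?H C) C"
  have yn: "y \<in> nodes G" using step_nodes[OF assms(2) snoc.hyps(2)] by simp
  show ?case
  proof (cases "passes (An ?H C) C r m y")
    case True
    then show ?thesis by (rule conn.snoc[OF snoc.IH snoc.hyps(2)])
  next
    case False
    with snoc.hyps(3) have rm: "r" "m" "y \<in> An G C" "y \<notin> An ?H C"
      by (auto simp: passes_def split: if_splits)
    then have ya: "(y, a) \<in> (dir ?H)\<^sup>*" and b: "b \<in> An ?H C"
      using An_del_directed[OF rm(3) assms(2), of a b] by auto
    have yC: "y \<notin> C" using An_self[of y C ?H] rm(4) yn by auto
    have aC: "a \<notin> C"
    proof
      assume "a \<in> C"
      then have "y \<in> An ?H C" using ya yn by (auto simp: An_def)
      with rm(4) show False by simp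
    qed
    have st: "step G a False b True" using assms(3) by (simp add: step_iff)
    have yb: "?K y False b True"
    proof (cases "y = a")
      case True
      then show ?thesis using st by (auto intro: conn.single)
    next
      case False
      then have "(y, a) \<in> (dir ?H)\<^sup>+" using ya by (metis rtranclD)
      from conn_directed[OF this _ rm(4) is_dmg_del[OF assms(2)]] yn
      have "conn (step ?H) (An ?H C) C y False a True" by simp
      then have "?K y False a True" by (rule conn_mono) (auto intro: step_del)
      then show ?thesis by (rule conn.snoc[where E = "step G", OF _ st]) (simp add: passes_def aC)
    qed
    have "?K y False y False"
      by (rule conn_join[OF conn_step_rev[OF yb] yb]) (simp add: passes_def b)
    \<comment> \<open>Both visits to \<open>y\<close> are now noncolliders, so \<open>y\<close>
      being outside \<open>C\<close> suffices.\<close>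
    from conn_join[OF this snoc.IH] have "?K x l y False" using yC by (simp add: passes_def)
    then show ?thesis by (rule conn.snoc[where E = "step G", OF _ snoc.hyps(2)]) (simp add: passes_def yC)
  qed
qed

lemma step_del_directed:
  "step G x l y r \<Longrightarrow> step (del_edge G (Directed a b)) x l y r \<or>
     x = a \<and> \<not> l \<and> y = b \<and> r \<or> x = b \<and> l \<and> y = a \<and> \<not> r"
  by (auto simp: step_iff)

text \<open>Three passes: colliders are adapted to the smaller ancestor sets, then traversals from
  \<open>a\<close> to \<open>b\<close> are removed, and after reversing the walk also those from
  \<open>b\<close> to \<open>a\<close>.\<close>

lemma conn_del_directed:
  assumes "conn (step G) (An G C) C x l y True" "x \<notin> C" "is_dmg G" "Directed a b \<in> edges G"
    and bi: "Bidirected (Upair a b) \<in> edges G"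
    and into: "\<And>x l. step G x l a True \<Longrightarrow> step G x l b True"
  shows "\<exists>l. conn (step (del_edge G (Directed a b))) (An (del_edge G (Directed a b)) C) C x l y True"
proof -
  let ?H = "del_edge G (Directed a b)"
  let ?E = "\<lambda>x l y r. step G x l y r \<and> \<not> (x = a \<and> \<not> l \<and> y = b \<and> r)"
  have ab: "step ?H a True b True" using bi by (simp add: step_iff)
  have "conn (step G) (An ?H C) C x l y True"
    by (rule conn_An_del[OF assms(1,3,4)])
  then have "\<exists>l'. (l \<longrightarrow> l') \<and> conn ?E (An ?H C) C x l' y True"
    by (rule conn_remove_edge[where a = a and b = b])
      (use assms(2) into ab in \<open>auto dest: step_del\<close>)
  then obtain l' where "conn ?E (An ?H C) C x l' y True" by blast
  then have "conn (\<lambda>x l y r. ?E y r x l) (An ?H C) C y True x l'"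
    by (rule conn_rev)
  \<comment> \<open>The mark at the start can only turn into a head, so the head at \<open>y\<close>
    survives.\<close>
  then have "\<exists>k. (True \<longrightarrow> k) \<and> conn (step ?H) (An ?H C) C y k x l'"
  proof (rule conn_remove_edge[where a = a and b = b])
    show "step ?H x l b True \<or> x = a \<and> \<not> l" if "step ?H x l a True" for x l
      using into[OF step_del[OF that]] step_del_directed[of G x l b True a b] by blast
    show "step ?H x l y r \<or> x = a \<and> \<not> l \<and> y = b \<and> r" if "?E y r x l" for x l y r
      using that step_del_directed[of G y r x l a b] step_sym[of ?H y r x l] by blast
  qed (use ab in auto)
  then have "conn (step ?H) (An ?H C) C y True x l'" by auto
  from conn_step_rev[OF this] show ?thesis by blast
qed

section \<open>Consequences of maximality and the equivalence\<close>

text \<open>Appending the bidirected edge to the one into \<open>a\<close> gives an inducing walk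
  from \<open>x\<close> to \<open>b\<close>, since its collider \<open>a\<close> is a parent of
  \<open>b\<close>. If \<open>l\<close> is a tail, the directed path through \<open>a\<close> is
  available as well.\<close>

lemma maximal_step_into:
  assumes "is_maximal G" "is_dmg G" "Directed a b \<in> edges G" "Bidirected (Upair a b) \<in> edges G"
    and xa: "step G x l a True"
  shows "step G x l b True"
proof -
  have n: "x \<in> nodes G" "a \<in> nodes G" "b \<in> nodes G"
    using step_nodes[OF assms(2) xa] dir_nodes[OF assms(2), of a b] assms(3) by auto
  have ab: "step G a True b True" using assms(4) by (simp add: step_iff)
  have "a \<in> An G {x, b}" using n assms(3) by (auto simp: An_def)
  then have c: "conn (step G) (An G {x, b}) UNIV x l b True"
    by (intro conn.snoc[OF conn.single[where E = "step G", OF xa] ab]) (simp add: passes_def)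
  show ?thesis
  proof (cases l)
    case True
    then show ?thesis using maximal_bidirectedI[OF assms(1,2) n(1,3)] c by (simp add: step_iff)
  next
    case False
    then have "Directed x a \<in> edges G" using xa by (simp add: step_iff)
    then have "(x, b) \<in> (dir G)\<^sup>+" using assms(3) by (auto intro: trancl_into_trancl)
    from maximal_directedI[OF assms(1,2) this n(1,3) c] False show ?thesis
      by (simp add: step_iff)
  qed
qed

text \<open>After an initial tail, the next node \<open>z\<close> is a child of \<open>a\<close> and
  the rest of the walk is inducing from \<open>z\<close> to \<open>b\<close>. Maximality then puts
  \<open>z\<close> among the parents of \<open>b\<close>; as \<open>z\<close> is not
  \<open>a\<close>, that edge survives in \<open>H\<close> and completes a forbidden directed
  path.\<close>

lemma maximal_inducing_head:
  assumes "is_maximal G" "is_dmg G" "Directed a b \<in> edges G"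
    and H: "H = del_edge G (Directed a b)" and nt: "(a, b) \<notin> (dir H)\<^sup>+"
    and "conn (step H) (An H {a, b} - {a}) UNIV a l b True"
  shows l
proof (rule ccontr)
  assume l: "\<not> l"
  from assms(6) show False
  proof (cases rule: conn_cons_cases)
    case 1
    then have "(a, b) \<in> dir H" using l by (simp add: step_iff)
    then show False using nt by blast
  next
    case (2 z s m)
    then have z: "z \<in> An H {a, b}" "z \<noteq> a" "s" "m" by (auto simp: passes_def split: if_splits)
    have az: "(a, z) \<in> dir H" using 2(1) l by (simp add: step_iff)
    then have zb: "z \<noteq> b" using nt by blast
    have n: "a \<in> nodes G" "b \<in> nodes G" using dir_nodes[OF assms(2), of a b] assms(3) by auto
    have zn: "z \<in> nodes G" using z(1) by (simp add: An_def H)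
    \<comment> \<open>In \<open>G\<close>, \<open>a\<close> is a parent of \<open>b\<close>, so
      ancestors of either are ancestors of \<open>b\<close>.\<close>
    have "An H {a, b} \<subseteq> An G {a, b}" unfolding H by (rule An_del)
    also have "{a, b} \<subseteq> An G {b}" using n assms(3) by (auto simp: An_def)
    then have "An G {a, b} \<subseteq> An G (An G {b})" by (intro An_mono) auto
    also have "\<dots> \<subseteq> An G {b}" by (rule An_An)
    finally have An: "An H {a, b} \<subseteq> An G {b}" .
    have Ab: "An G {b} \<subseteq> An G {z, b}" by (rule An_mono) auto
    have "conn (step G) (An G {z, b}) UNIV z m b True"
      using 2(3) by (rule conn_mono) (use An Ab H in \<open>auto intro: step_del\<close>)
    moreover have "(z, b) \<in> (dir G)\<^sup>*" using z(1) An by (auto simp: An_def)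
    then have "(z, b) \<in> (dir G)\<^sup>+" using zb by (metis rtranclD)
    ultimately have "Directed z b \<in> edges G"
      using maximal_directedI[OF assms(1,2) _ zn n(2)] by blast
    then have "(z, b) \<in> dir H" using z(2) H by simp
    with az have "(a, b) \<in> (dir H)\<^sup>+" by (rule trancl_into_trancl[OF r_into_trancl])
    then show False using nt by simp
  qed
qed

lemma indep_model_del_directed:
  assumes max: "is_maximal G" and dmg: "is_dmg G" and ab: "Directed a b \<in> edges G"
    and H: "H = del_edge G (Directed a b)"
    and ind: "conn (step H) (An H {a, b} - {a}) UNIV a l b True"
  shows "indep_model H = indep_model G"
proof -
  have n: "a \<in> nodes G" "b \<in> nodes G" using dir_nodes[OF dmg, of a b] ab by auto
  have dH: "is_dmg H" using dmg H by (simp add: is_dmg_del)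
  show ?thesis
  proof (cases "(a, b) \<in> (dir H)\<^sup>+")
    case True
    have "conn (step H) (An H {a, b}) UNIV a l b True"
      using ind by (rule conn_mono) auto
    from indep_model_add_directed[OF dH True _ _ this] n show ?thesis
      using add_del_edge[OF ab] by (simp add: H)
  next
    case False
    then have l using maximal_inducing_head[OF max dmg ab H _ ind] by blast
    then have "conn (step H) (An H {a, b} - {a}) UNIV a True b True" using ind by simp
    then have "conn (step G) (An G {a, b}) UNIV a True b True"
      by (rule conn_mono) (use An_del[of G _ "{a, b}"] in \<open>auto intro: step_del simp: H\<close>)
    then have bi: "Bidirected (Upair a b) \<in> edges G"
      by (rule maximal_bidirectedI[OF max dmg n])
    show ?thesis
    proof (rule indep_model_eqI)
      fix C x k y
      assume "conn (step H) (An H C) C x k y True"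
      then have "conn (step G) (An G C) C x k y True"
        by (rule conn_mono) (use An_del[of G _ C] in \<open>auto intro: step_del simp: H\<close>)
      then show "\<exists>k. conn (step G) (An G C) C x k y True" by blast
    next
      fix C x k y
      assume "x \<notin> C" "conn (step G) (An G C) C x k y True"
      then show "\<exists>k. conn (step H) (An H C) C x k y True"
        unfolding H using conn_del_directed[OF _ _ dmg ab bi maximal_step_into[OF max dmg ab bi]]
        by blast
    qed (use dH dmg H in auto)
  qed
qed

theorem proposition5p11:
  fixes N :: "'a dmg" and \<alpha> \<beta> :: 'a
  assumes "is_dmg N"
    and "is_maximal N"
    and "\<alpha> \<in> nodes N" and "\<beta> \<in> nodes N"
    and "Directed \<alpha> \<beta> \<in> edges N"
  defines "N' \<equiv> del_edge N (Directed \<alpha> \<beta>)"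
  shows "(markov_equivalent N' N \<longleftrightarrow> \<alpha> \<in> u_set (nodes N) \<beta> (indep_model N')) \<and>
         (markov_equivalent N' N \<longleftrightarrow> \<not> (\<exists>C \<subseteq> nodes N - {\<alpha>}. mu_separated N' {\<alpha>} {\<beta>} C))"
proof -
  have nodes: "nodes N' = nodes N" by (simp add: N'_def)
  have dmg': "is_dmg N'" using assms(1) by (simp add: N'_def is_dmg_del)
  have im: "({\<alpha>}, {\<beta>}, C) \<in> indep_model G \<longleftrightarrow> mu_separated G {\<alpha>} {\<beta>} C"
    if "C \<subseteq> nodes N" "nodes G = nodes N" for G C
    using that assms by (simp add: indep_model_def)
  have u: "\<alpha> \<in> u_set (nodes N) \<beta> (indep_model N') \<longleftrightarrow>
      \<not> (\<exists>C \<subseteq> nodes N - {\<alpha>}. mu_separated N' {\<alpha>} {\<beta>} C)"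
    unfolding u_set_def using im[OF _ nodes] assms(3) by blast
  have "markov_equivalent N' N \<longleftrightarrow> \<not> (\<exists>C \<subseteq> nodes N - {\<alpha>}. mu_separated N' {\<alpha>} {\<beta>} C)"
  proof
    assume "markov_equivalent N' N"
    then have eq: "indep_model N' = indep_model N" by (simp add: markov_equivalent_def)
    show "\<not> (\<exists>C \<subseteq> nodes N - {\<alpha>}. mu_separated N' {\<alpha>} {\<beta>} C)"
    proof clarify
      fix C assume C: "C \<subseteq> nodes N - {\<alpha>}" "mu_separated N' {\<alpha>} {\<beta>} C"
      then have "mu_separated N {\<alpha>} {\<beta>} C" using im[of C] nodes eq by blast
      \<comment> \<open>This edge alone is a connecting walk given any \<open>C\<close> without
        \<alpha>.\<close>
      moreover have "step N \<alpha> False \<beta> True" using assms(5) by (simp add: step_iff)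
      ultimately show False
        using C conn.single[of "step N" \<alpha> False \<beta> True "An N C" C]
        by (auto simp: mu_separated_conn[OF assms(1)])
    qed
  next
    assume no: "\<not> (\<exists>C \<subseteq> nodes N - {\<alpha>}. mu_separated N' {\<alpha>} {\<beta>} C)"
    have "\<exists>l. conn (step N') (An N' C) C \<alpha> l \<beta> True" if "C \<subseteq> nodes N' - {\<alpha>}" for C
      using no that mu_separated_conn[OF dmg', of "{\<alpha>}" "{\<beta>}" C] nodes by auto
    then obtain l where "conn (step N') (An N' {\<alpha>, \<beta>} - {\<alpha>}) UNIV \<alpha> l \<beta> True"
      using inducing_walk_exists[OF dmg', of \<alpha> \<beta>] assms(3,4) nodes by auto
    from indep_model_del_directed[OF assms(2,1,5) _ this] show "markov_equivalent N' N"
      by (simp add: N'_def markov_equivalent_def)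
  qed
  with u show ?thesis by simp
qed

end
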